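(* Every polynomial in $\mathcal{LP}_4$ is of the form $f[h,h']$, where $$f:=(a^3xy+a(x+y)+a^2)xy+x+y\in\mathcal{RLP}_4,\qquad h:=bx^2+cx+d\in\mathcal{P}_4,\qquad h':=b'x^2+c'x+d'\in\mathcal{P}_4,$$ with $a,b,c,d,b',c',d'\in\mathbb{F}_4$ such that $b^3+c^3=1=b'^3+c'^3$.
   Context: $\mathbb{F}_4$ is the field with four elements. $\mathcal{P}_4$ is the set of polynomials in $\mathbb{F}_4[x]$ of degree less than $4$ that act as permutations of $\mathbb{F}_4$. $\mathcal{LP}_4$ is the set of polynomials $f\in\mathbb{F}_4[x,y]$ of degree less than $4$ in each variable such that, for every $a\in\mathbb{F}_4$, both $f(x,a)$ and $f(a,x)$ act as permutations of $\mathbb{F}_4$. $\mathcal{RLP}_4$ is the set of reduced polynomials in $\mathcal{LP}_4$, i.e. those $f$ with $f(x,0)=x$ and $f(0,y)=y$. For $f\in\mathcal{LP}_4$ and $g,h\in\mathcal{P}_4$, $f[g,h]:=f(g(x),h(y))$, the composition being taken modulo $x^4-x$ and $y^4-y$. *)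

theory Defs
  imports "HOL-Computational_Algebra.Polynomial"
begin

(* A polynomial in F[x,y] is an element of F[x][y], of type 'a poly poly: the outer
   variable is y and the coefficients are polynomials in x. *)

definition var_x :: "'a::comm_ring_1 poly poly" where
  "var_x = [:[:0, 1:]:]"

definition var_y :: "'a::comm_ring_1 poly poly" where
  "var_y = [:0, 1:]"

definition const2 :: "'a::comm_ring_1 \<Rightarrow> 'a poly poly" where
  "const2 a = [:[:a:]:]"

(* f(x,a) and f(a,y), as one-variable polynomials *)

definition subst_y :: "'a::comm_ring_1 poly poly \<Rightarrow> 'a \<Rightarrow> 'a poly" where
  "subst_y f a = poly f [:a:]"

definition subst_x :: "'a::comm_ring_1 poly poly \<Rightarrow> 'a \<Rightarrow> 'a poly" where
  "subst_x f a = map_poly (\<lambda>c. poly c a) f"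

definition P4 :: "'a::field poly set" where
  "P4 = {g. degree g < 4 \<and> bij (poly g)}"

definition LP4 :: "'a::field poly poly set" where
  "LP4 = {f. degree f < 4 \<and> (\<forall>i. degree (coeff f i) < 4) \<and>
             (\<forall>a. bij (poly (subst_y f a)) \<and> bij (poly (subst_x f a)))}"

definition RLP4 :: "'a::field poly poly set" where
  "RLP4 = {f \<in> LP4. subst_y f 0 = [:0, 1:] \<and> subst_x f 0 = [:0, 1:]}"

(* f(g(x),h(y)) in F[x,y]: g replaces x inside the coefficients of f, and h replaces the
   outer variable y (with its coefficients embedded as constants of F[x]) *)

definition comp2 :: "'a::field poly poly \<Rightarrow> 'a poly \<Rightarrow> 'a poly \<Rightarrow> 'a poly poly" where
  "comp2 f g h = pcompose (map_poly (\<lambda>c. pcompose c g) f) (map_poly (\<lambda>c. [:c:]) h)"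

(* Remainder modulo x^4 - x and y^4 - y. F[x] is not a field, so mod is not available on
   F[x][y]; since y^4 - y is monic in y, pseudo_mod is the ordinary remainder
   (see pseudo_mod_monic). *)

definition reduce4 :: "'a::field poly poly \<Rightarrow> 'a poly poly" where
  "reduce4 f = map_poly (\<lambda>c. c mod (monom 1 4 - monom 1 1))
                 (pseudo_mod f (monom 1 4 - monom 1 1))"

lemma pseudo_mod_monic:
  fixes p q :: "'a::idom poly"
  assumes "lead_coeff q = 1" "degree q > 0"
  shows "degree (pseudo_mod p q) < degree q" and "q dvd p - pseudo_mod p q"
proof -
  have q0: "q \<noteq> 0" using assms by auto
  show "degree (pseudo_mod p q) < degree q"
    using pseudo_mod(2)[OF q0, of p] assms(2) by auto
  obtain a r where "a \<noteq> 0" "smult a p = q * r + pseudo_mod p q"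
    and "a = lead_coeff q ^ (Suc (degree p) - degree q)"
    using q0 pseudo_divmod(1)[OF q0, of p "fst (pseudo_divmod p q)" "pseudo_mod p q"]
    by (auto simp: pseudo_mod_def assms)
  then show "q dvd p - pseudo_mod p q"
    using assms(1) by (metis add_diff_cancel_right' dvd_triv_left power_one smult_1_left)
qed

(* f[g,h] *)

definition lcomp :: "'a::field poly poly \<Rightarrow> 'a poly \<Rightarrow> 'a poly \<Rightarrow> 'a poly poly" where
  "lcomp f g h = reduce4 (comp2 f g h)"

definition fpoly :: "'a::field \<Rightarrow> 'a poly poly" where
  "fpoly a = (const2 (a^3) * var_x * var_y + const2 a * (var_x + var_y) + const2 (a^2))
               * var_x * var_y + var_x + var_y"

definition hpoly :: "'a::field \<Rightarrow> 'a \<Rightarrow> 'a \<Rightarrow> 'a poly" where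
  "hpoly b c d = monom b 2 + monom c 1 + monom d 0"

end

theory Submission
  imports Defs
begin

text \<open>A polynomial reduced in both variables is determined by its values, so the claim concerns
Latin squares on the four-element field. The polynomials \<open>b x\<^sup>2 + c x + d\<close> with exactly one of
\<open>b\<close>, \<open>c\<close> nonzero represent all 24 permutations of the field. Permuting the rows and then the
columns of a Latin square makes \<open>0\<close> a two-sided identity, and there are exactly four Latin
squares with this property: the addition table and three tables of cyclic groups. They are the
tables of the polynomials \<open>fpoly a\<close> for the four choices of \<open>a\<close>.\<close>

section \<open>Evaluation of polynomials in two variables and reduction\<close>

definition eval2 :: "'a::comm_ring_1 poly poly \<Rightarrow> 'a \<Rightarrow> 'a \<Rightarrow> 'a" where
  "eval2 f x y = poly (poly f [:y:]) x"

lemma eval2_0 [simp]: "eval2 0 x y = 0"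
  by (simp add: eval2_def)

lemma eval2_pCons [simp]: "eval2 (pCons c f) x y = poly c x + y * eval2 f x y"
  by (simp add: eval2_def)

lemma poly_subst_y: "poly (subst_y f y) = (\<lambda>x. eval2 f x y)"
  by (simp add: subst_y_def eval2_def fun_eq_iff)

lemma poly_subst_x: "poly (subst_x f x) = eval2 f x"
proof
  show "poly (subst_x f x) y = eval2 f x y" for y
    unfolding subst_x_def by (induction f) (simp_all add: map_poly_pCons)
qed

lemma eval2_comp2: "eval2 (comp2 f g h) x y = eval2 f (poly g x) (poly h y)"
proof -
  have const: "poly (map_poly (\<lambda>c. [:c:]) h) [:y:] = [:poly h y:]"
    by (induction h) (simp_all add: map_poly_pCons)
  have "eval2 (map_poly (\<lambda>c. pcompose c g) f) x z = eval2 f (poly g x) z" for z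
    by (induction f) (simp_all add: map_poly_pCons poly_pcompose)
  then show ?thesis
    by (simp add: comp2_def eval2_def poly_pcompose const)
qed

lemma degree_monom_diff_monom:
  "m < n \<Longrightarrow> degree (monom (1::'a::comm_ring_1) n - monom 1 m) = n"
  unfolding diff_conv_add_uminus by (subst degree_add_eq_left) (simp_all add: degree_monom_eq)

lemma degree_reduce4: "degree (reduce4 f) < 4"
proof -
  have "degree (pseudo_mod f (monom 1 4 - monom 1 1)) < 4"
    using pseudo_mod_monic(1)[of "monom 1 4 - monom (1::'a poly) 1" f]
    by (simp add: degree_monom_diff_monom)
  then show ?thesis
    unfolding reduce4_def by (rule le_less_trans[OF map_poly_degree_leq])
qed

lemma degree_coeff_reduce4: "degree (coeff (reduce4 f) i) < 4"
proof -
  have "degree (c mod (monom 1 4 - monom 1 1)) < 4" for c :: "'a poly"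
    using degree_mod_less[of "monom 1 4 - monom (1::'a) 1" c]
      degree_monom_diff_monom[of 1 4, where 'a = 'a] by fastforce
  then show ?thesis
    by (simp add: reduce4_def coeff_map_poly)
qed

text \<open>When \<open>z^4 = z\<close> for all \<open>z\<close>, both moduli vanish at every point,
  so passing to either remainder keeps all values.\<close>

lemma eval2_reduce4:
  fixes f :: "'a::field poly poly"
  assumes fermat: "\<And>z::'a. z ^ 4 = z"
  shows "eval2 (reduce4 f) x y = eval2 f x y"
proof -
  let ?m = "monom 1 4 - monom (1::'a) 1" and ?M = "monom 1 4 - monom (1::'a poly) 1"
  have m: "poly (c mod ?m) x = poly c x" for c
  proof -
    have "poly c x = poly (c div ?m * ?m + c mod ?m) x"
      by (simp only: div_mult_mod_eq)
    also have "\<dots> = poly (c mod ?m) x"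
      by (simp add: poly_monom fermat del: div_mult_mod_eq)
    finally show ?thesis ..
  qed
  have "eval2 (map_poly (\<lambda>c. c mod ?m) r) x y = eval2 r x y" for r
    by (induction r) (simp_all add: map_poly_pCons m del: One_nat_def)
  moreover obtain q where "f - pseudo_mod f ?M = ?M * q"
    using pseudo_mod_monic(2)[of ?M f] by (auto simp: degree_monom_diff_monom)
  then have "eval2 f x y = eval2 (?M * q + pseudo_mod f ?M) x y"
    by (metis diff_add_cancel)
  then have "eval2 f x y = eval2 (pseudo_mod f ?M) x y"
    by (simp add: eval2_def poly_monom poly_const_pow fermat)
  ultimately show ?thesis
    by (simp add: reduce4_def)
qed

text \<open>A polynomial in one variable with degree below the field size is determined by its
  values. This is used in \<open>y\<close> for each fixed \<open>x\<close>, then in \<open>x\<close>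
  for each coefficient.\<close>

lemma eval2_eqI:
  fixes f g :: "'a::field poly poly"
  assumes "degree f < card (UNIV :: 'a set)" "degree g < card (UNIV :: 'a set)"
    and "\<And>i. degree (coeff f i) < card (UNIV :: 'a set)"
    and "\<And>i. degree (coeff g i) < card (UNIV :: 'a set)"
    and "\<And>x y. eval2 f x y = eval2 g x y"
  shows "f = g"
proof -
  have deg: "degree (subst_x p x) \<le> degree p" for p :: "'a poly poly" and x
    unfolding subst_x_def by (rule map_poly_degree_leq)
  have "subst_x f x = subst_x g x" for x
  proof (rule poly_eqI_degree)
    show "poly (subst_x f x) y = poly (subst_x g x) y" for y
      by (simp add: poly_subst_x assms(5))
  qed (use assms(1,2) deg in \<open>blast intro: le_less_trans\<close>)+
  then have "poly (coeff f i) x = poly (coeff g i) x" for i x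
    by (metis coeff_map_poly poly_0 subst_x_def)
  then have "coeff f i = coeff g i" for i
    by (intro poly_eqI_degree[of UNIV]) (use assms in auto)
  then show ?thesis
    by (rule poly_eqI)
qed

lemma fpoly_eq: "fpoly a = [:[:0, 1:], [:1, a^2, a:], [:0, a, a^3:]:]"
  by (simp add: fpoly_def const2_def var_x_def var_y_def one_pCons)

lemma eval2_fpoly:
  "eval2 (fpoly a) x y = (a^3 * x * y + a * (x + y) + a^2) * x * y + x + y"
  by (simp add: fpoly_eq algebra_simps)

lemma poly_hpoly: "poly (hpoly b c d) x = b * x^2 + c * x + d"
  by (simp add: hpoly_def poly_monom)

section \<open>Arithmetic tables of the field with four elements\<close>

locale field4 =
  fixes w v :: "'a::field"
  assumes UNIV_eq: "UNIV = {0, 1, w, v}"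
    and distinct: "distinct [0, 1, w, v]"
begin

lemma card_UNIV: "card (UNIV :: 'a set) = 4"
  using distinct by (simp add: UNIV_eq)

lemma cases4: "z = 0 \<or> z = 1 \<or> z = w \<or> z = v"
  using UNIV_eq by blast

lemma all_iff: "(\<forall>z. P z) \<longleftrightarrow> P 0 \<and> P 1 \<and> P w \<and> P v"
  by (metis cases4)

lemma ex_iff: "(\<exists>z. P z) \<longleftrightarrow> P 0 \<or> P 1 \<or> P w \<or> P v"
  by (metis cases4)

lemma neqs [simp]: "w \<noteq> 0" "w \<noteq> 1" "v \<noteq> 0" "v \<noteq> 1" "w \<noteq> v" "v \<noteq> w"
    "0 \<noteq> w" "1 \<noteq> w" "0 \<noteq> v" "1 \<noteq> v"
  using distinct by auto

text \<open>The product \<open>w * v\<close> is nonzero and, by cancellation, equals neither factor,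
  which leaves 1. The squares follow likewise: \<open>w * w = 1\<close> would give
  \<open>w = v\<close>.\<close>

lemma mult_table [simp]: "w * v = 1" "v * w = 1" "w * w = v" "v * v = w"
proof -
  show 1: "w * v = 1"
    using cases4[of "w * v"] by auto
  then show "v * w = 1"
    by (simp add: mult.commute)
  show "w * w = v"
    using cases4[of "w * w"] 1 by (metis mult_cancel_left mult_cancel_left1 mult_eq_0_iff neqs)
  show "v * v = w"
    using cases4[of "v * v"] 1 by (metis mult_cancel_right mult_cancel_right1 mult_eq_0_iff neqs)
qed

text \<open>The element \<open>-1\<close> has square 1, while \<open>w\<close> and \<open>v\<close>
  square to each other; hence \<open>-1 = 1\<close>.\<close>

lemma two_eq_0 [simp]: "(2::'a) = 0"
proof -
  have "(-1) * (-1) = (1::'a)"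
    by simp
  then have "-1 = (1::'a)"
    using cases4[of "-1"] by (metis mult_table(3,4) neqs(2,4) neg_equal_0_iff_equal one_neq_zero)
  then show ?thesis
    by (metis add.right_inverse one_add_one)
qed

lemma add_self [simp]: "z + z = (0::'a)"
  by (simp flip: mult_2)

lemma uminus_eq [simp]: "- z = (z::'a)"
  by (simp add: minus_unique)

text \<open>In characteristic 2 distinct elements have a nonzero sum, and a sum of two nonzero
  elements differs from both summands; one value is left.\<close>

lemma add_table [simp]:
  "1 + w = v" "w + 1 = v" "1 + v = w" "v + 1 = w" "w + v = 1" "v + w = 1"
proof -
  have nz: "x + y \<noteq> 0" if "x \<noteq> y" for x y :: 'a
    using that by (metis eq_neg_iff_add_eq_0 uminus_eq)
  show "1 + w = v"
    using cases4[of "1 + w"] nz[of 1 w] by auto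
  moreover show "1 + v = w"
    using cases4[of "1 + v"] nz[of 1 v] by auto
  moreover show "w + v = 1"
    using cases4[of "w + v"] nz[of w v] by auto
  ultimately show "w + 1 = v" "v + 1 = w" "v + w = 1"
    by (simp_all add: add.commute)
qed

lemma power4_eq: "z ^ 4 = (z::'a)"
  using cases4[of z] by (auto simp: power4_eq_xxxx)

lemma bij_iff:
  "bij (k :: 'a \<Rightarrow> 'a) \<longleftrightarrow> distinct [k 0, k 1, k w, k v]"
proof -
  have "finite (UNIV :: 'a set)"
    by (simp add: UNIV_eq)
  then have "bij k \<longleftrightarrow> inj k"
    unfolding bij_def using finite_UNIV_inj_surj by blast
  also have "\<dots> \<longleftrightarrow> distinct [k 0, k 1, k w, k v]"
    by (auto simp: inj_def all_iff)
  finally show ?thesis .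
qed

section \<open>Permutations and Latin squares of the field\<close>

lemma fpoly_RLP4: "fpoly (a :: 'a) \<in> RLP4"
proof -
  have "degree (fpoly a) < 4" "degree (coeff (fpoly a) i) < 4" for i
    by (auto simp: fpoly_eq coeff_pCons split: nat.split)
  moreover have "bij (\<lambda>x. eval2 (fpoly a) x b)" "bij (\<lambda>y. eval2 (fpoly a) b y)" for b
    using cases4[of a] cases4[of b]
    by (auto simp: bij_iff eval2_fpoly power2_eq_square power3_eq_cube)
  moreover have "subst_y (fpoly a) 0 = [:0, 1:]" "subst_x (fpoly a) 0 = [:0, 1:]"
    by (simp_all add: subst_y_def subst_x_def fpoly_eq map_poly_pCons)
  ultimately show ?thesis
    by (simp add: RLP4_def LP4_def poly_subst_x poly_subst_y)
qed

text \<open>Nonzero elements have cube 1 and \<open>1 + 1 = 0\<close>, so the hypothesis says that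
  exactly one of \<open>b\<close>, \<open>c\<close> is nonzero. Both \<open>x\<close> and
  \<open>x^2\<close> permute the field.\<close>

lemma hpoly_P4:
  assumes "b^3 + c^3 = (1::'a)"
  shows "hpoly b c d \<in> P4"
proof -
  have "degree (hpoly b c d) \<le> 2"
    unfolding hpoly_def by (intro degree_add_le order.trans[OF degree_monom_le]) auto
  moreover have "bij (poly (hpoly b c d))"
    using assms cases4[of b] cases4[of c] cases4[of d]
    by (auto simp: bij_iff poly_hpoly power2_eq_square power3_eq_cube)
  ultimately show ?thesis
    by (simp add: P4_def)
qed

lemma bij_eq_hpoly:
  assumes "bij (k :: 'a \<Rightarrow> 'a)"
  obtains b c d where "b^3 + c^3 = 1" "k = poly (hpoly b c d)"
proof -
  \<comment> \<open>From \<open>q + p = b + c\<close> and \<open>r + p = b * v + c * w\<close>,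
    eliminating \<open>c\<close> leaves \<open>b * (v + w) = b\<close>. The value at
    \<open>v\<close> then fits, since the four values of a permutation, like those of the
    polynomial, sum to 0.\<close>
  have interpolate: "b^3 + c^3 = 1 \<and> q = b + c + p \<and>
      r = b * w^2 + c * w + p \<and> s = b * v^2 + c * v + p"
    if "distinct [p, q, r, s]" "b = r + p + (q + p) * w" "c = q + p + b" for p q r s b c :: 'a
    using cases4[of p] cases4[of q] cases4[of r] cases4[of s] that
    by (elim disjE; simp add: power2_eq_square power3_eq_cube)
  define b where "b = k w + k 0 + (k 1 + k 0) * w"
  define c where "c = k 1 + k 0 + b"
  have *: "b^3 + c^3 = 1 \<and> k 1 = b + c + k 0 \<and>
      k w = b * w^2 + c * w + k 0 \<and> k v = b * v^2 + c * v + k 0"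
    using assms by (intro interpolate) (simp_all only: bij_iff b_def c_def)
  then have "\<forall>x. k x = poly (hpoly b c (k 0)) x"
    unfolding all_iff poly_hpoly by simp
  with * show thesis
    using that by blast
qed

text \<open>The entry \<open>G 1 1\<close> is 0, \<open>w\<close> or \<open>v\<close>, and it fixes
  row 1 and column 1. The rest is forced if \<open>G 1 1\<close> is nonzero and has two completions
  otherwise: four squares in all.\<close>

lemma reduced_latin_eq_fpoly:
  fixes G :: "'a \<Rightarrow> 'a \<Rightarrow> 'a"
  assumes "\<And>x. bij (G x)" "\<And>y. bij (\<lambda>x. G x y)"
    and "\<And>x. G x 0 = x" "\<And>y. G 0 y = y"
  obtains a where "G = eval2 (fpoly a)"
proof -
  have rows: "distinct [x, G x 1, G x w, G x v]" for x
    using assms(1)[of x] by (simp add: bij_iff assms(3))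
  have cols: "distinct [y, G 1 y, G w y, G v y]" for y
    using assms(2)[of y] by (simp add: bij_iff assms(4))
  have row1: "G 1 1 = 0 \<and> G 1 w = v \<and> G 1 v = w \<or> G 1 1 = w \<and> G 1 w = v \<and> G 1 v = 0 \<or>
      G 1 1 = v \<and> G 1 w = 0 \<and> G 1 v = w"
    using rows[of 1] cols[of w] cols[of v]
      cases4[of "G 1 1"] cases4[of "G 1 w"] cases4[of "G 1 v"]
    by auto
  \<comment> \<open>Column 1 obeys the same constraints as row 1, whose three options already differ
    in \<open>G 1 1\<close>.\<close>
  moreover have "G w 1 = G 1 w" "G v 1 = G 1 v"
    using row1 rows[of w] rows[of v] cols[of 1] cases4[of "G w 1"] cases4[of "G v 1"]
    by (elim disjE conjE; simp)+
  \<comment> \<open>The value of \<open>fpoly a\<close> at (1, 1) is \<open>a^3 + a^2\<close>: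
    \<open>w\<close> for \<open>a = w\<close>, \<open>v\<close> for \<open>a = v\<close>, and 0 for
    \<open>a = 0\<close> and \<open>a = 1\<close>, which give the two completions.\<close>
  ultimately have "\<exists>a. \<forall>x y. G x y = eval2 (fpoly a) x y"
    using rows[of w] rows[of v] cols[of w] cols[of v]
      cases4[of "G w w"] cases4[of "G w v"] cases4[of "G v w"] cases4[of "G v v"]
    unfolding ex_iff all_iff eval2_fpoly assms(3,4)
    by (elim disjE) (simp_all add: power2_eq_square power3_eq_cube)
  then show thesis
    using that by blast
qed

lemma latin_eq_fpoly:
  fixes F :: "'a \<Rightarrow> 'a \<Rightarrow> 'a"
  assumes row: "\<And>x. bij (F x)" and col: "\<And>y. bij (\<lambda>x. F x y)"
  obtains a g h where "bij g" "bij h" "\<And>x y. F x y = eval2 (fpoly a) (g x) (h y)"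
proof -
  \<comment> \<open>Undoing \<open>g\<close>, which is column 0, makes column 0 the
    identity.\<close>
  define g where "g x = F x 0" for x
  have g: "bij g"
    unfolding g_def by (rule col)
  \<comment> \<open>This is the row with entry 0 in column 0. Hence \<open>h\<close> fixes 0, and
    undoing it makes row 0 the identity without disturbing column 0.\<close>
  define h where "h = F (inv g 0)"
  have h: "bij h"
    unfolding h_def by (rule row)
  have "F (inv g x) 0 = x" for x
    using g by (metis bij_inv_eq_iff g_def)
  then have h0: "inv h 0 = 0"
    using h by (metis bij_inv_eq_iff h_def)
  have "bij (F (inv g x) \<circ> inv h)" "bij ((\<lambda>x. F x (inv h y)) \<circ> inv g)" for x y
    using row col g h by (auto intro: bij_comp bij_imp_bij_inv)
  then obtain a where a: "(\<lambda>x y. F (inv g x) (inv h y)) = eval2 (fpoly a)"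
    using reduced_latin_eq_fpoly[of "\<lambda>x y. F (inv g x) (inv h y)"]
      \<open>\<And>x. F (inv g x) 0 = x\<close> h0 h
    by (auto simp: o_def h_def[symmetric, THEN fun_cong] bij_is_surj surj_f_inv_f)
  show thesis
  proof
    show "F x y = eval2 (fpoly a) (g x) (h y)" for x y
      using fun_cong[OF fun_cong[OF a], of "g x" "h y"] g h
      by (simp add: bij_is_inj)
  qed (use g h in auto)
qed

lemma LP4_eq_lcomp:
  assumes p: "p \<in> (LP4 :: 'a poly poly set)"
  shows "\<exists>a b c d b' c' d'. b^3 + c^3 = 1 \<and> b'^3 + c'^3 = 1 \<and>
           p = lcomp (fpoly a) (hpoly b c d) (hpoly b' c' d')"
proof -
  have "bij (\<lambda>y. eval2 p x y)" "bij (\<lambda>x. eval2 p x y)" for x y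
    using p by (auto simp: LP4_def poly_subst_x poly_subst_y)
  then obtain a g h where "bij g" "bij h"
    and eq: "\<And>x y. eval2 p x y = eval2 (fpoly a) (g x) (h y)"
    using latin_eq_fpoly[of "eval2 p"] by metis
  obtain b c d where g: "b^3 + c^3 = 1" "g = poly (hpoly b c d)"
    using bij_eq_hpoly[OF \<open>bij g\<close>] by blast
  obtain b' c' d' where h: "b'^3 + c'^3 = 1" "h = poly (hpoly b' c' d')"
    using bij_eq_hpoly[OF \<open>bij h\<close>] by blast
  \<comment> \<open>Both sides are reduced, so agreement of values suffices.\<close>
  have "p = lcomp (fpoly a) (hpoly b c d) (hpoly b' c' d')"
    using p unfolding lcomp_def
    by (intro eval2_eqI)
      (simp_all add: LP4_def card_UNIV degree_reduce4 degree_coeff_reduce4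
        eval2_reduce4[OF power4_eq] eval2_comp2 eq g(2) h(2))
  with g(1) h(1) show ?thesis
    by blast
qed

end

theorem theorem4p1:
  assumes "card (UNIV :: 'a::field set) = 4"
  shows "(\<forall>a::'a. fpoly a \<in> RLP4) \<and>
         (\<forall>b c d::'a. b^3 + c^3 = 1 \<longrightarrow> hpoly b c d \<in> P4) \<and>
         (\<forall>p \<in> (LP4 :: 'a poly poly set).
            \<exists>a b c d b' c' d'. b^3 + c^3 = 1 \<and> b'^3 + c'^3 = 1 \<and>
              p = lcomp (fpoly a) (hpoly b c d) (hpoly b' c' d'))"
proof -
  have "card (UNIV - {0, 1 :: 'a}) = 2"
    using assms by (subst card_Diff_subset) auto
  then obtain w v :: 'a where "UNIV - {0, 1} = {w, v}" "w \<noteq> v"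
    by (metis card_2_iff)
  then interpret field4 w v
    by unfold_locales auto
  show ?thesis
    using fpoly_RLP4 hpoly_P4 LP4_eq_lcomp by blast
qed

end
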